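(* Let $r(x)=\sum_{n\ge 0}x^{2^n-1}$ and $h_n=H_n(1-xr(x))$. For $y\in\mathbb{Z}$ let $y^+=y+1$ if $y>0$ and $y^+=y-1$ if $y\le 0$. Then $h_0=h_1=1$, $h_2=-2$, and for all $n\ge 0$: $h_{8n}=h_{4n}$, $h_{8n+1}=h_{4n+1}$, $h_{8n+2}=h_{4n+2}$, $h_{8n+3}=-(h_{4n+2})^+$, $h_{8n+4}=-h_{4n+2}$, $h_{8n+5}=-h_{4n+3}$, $h_{8n+6}=(h_{4n+3})^+$, $h_{8n+7}=h_{4n+3}$.
   Context: For a power series $f(x)=\sum_{i\ge 0}a_ix^i$ and $n\ge 1$, $H_n(f)=\det(a_{i+j})_{0\le i,j\le n-1}$, $H_0(f)=1$. *)

theory Defs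
  imports
    "HOL-Computational_Algebra.Formal_Power_Series"
    "Jordan_Normal_Form.Determinant"
begin

definition hankel_det :: "'a::comm_ring_1 fps \<Rightarrow> nat \<Rightarrow> 'a" where
  "hankel_det f n = det (mat n n (\<lambda>(i, j). fps_nth f (i + j)))"

lemma hankel_det_0 [simp]: "hankel_det f 0 = 1"
  by (simp add: hankel_det_def)

text \<open>The infinite sum is taken in the library's metric topology on formal power series,
  in which it converges (\<open>r_series_sums\<close>). In the exponent, \<open>2 ^ n \<ge> 1\<close>, so the subtraction
  on natural numbers is never truncated.\<close>

definition r_series :: "int fps" where
  "r_series = (\<Sum>n. fps_X ^ (2 ^ n - 1))"

lemma fps_nth_partial_r_series:
  assumes "k < N"
  shows "fps_nth (\<Sum>n<N. fps_X ^ (2 ^ n - 1) :: int fps) k =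
           (if \<exists>n. k = 2 ^ n - 1 then 1 else 0)"
proof -
  have eq: "fps_nth (\<Sum>n<N. fps_X ^ (2 ^ n - 1) :: int fps) k =
          (\<Sum>n<N. if k = 2 ^ n - 1 then 1 else 0)"
    by (simp add: fps_sum_nth fps_X_power_iff)
  show ?thesis
  proof (cases "\<exists>n. k = 2 ^ n - 1")
    case True
    then obtain m where m: "k = 2 ^ m - 1" by blast
    have "m < 2 ^ m" by (rule less_exp)
    then have "m < N" using m assms by linarith
    have inj: "(k = 2 ^ n - 1) = (n = m)" for n
    proof
      assume "k = 2 ^ n - 1"
      then have "(2::nat) ^ n = 2 ^ m"
        using m by (metis One_nat_def Suc_pred pos2 zero_less_power)
      then show "n = m" by simp
    qed (simp add: m)
    show ?thesis unfolding eq inj using \<open>m < N\<close> by simp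
  next
    case False
    then show ?thesis unfolding eq by (auto intro: sum.neutral)
  qed
qed

lemma r_series_sums_Abs:
  "(\<lambda>n. fps_X ^ (2 ^ n - 1) :: int fps) sums
     Abs_fps (\<lambda>k. if \<exists>n. k = 2 ^ n - 1 then 1 else 0)"
  unfolding sums_def
proof (rule tendsto_fpsI)
  fix k :: nat
  show "\<forall>\<^sub>F N in sequentially. fps_nth (\<Sum>n<N. fps_X ^ (2 ^ n - 1) :: int fps) k =
      fps_nth (Abs_fps (\<lambda>k. if \<exists>n. k = 2 ^ n - 1 then 1 else 0)) k"
    using eventually_gt_at_top[of k]
    by eventually_elim (simp only: fps_nth_partial_r_series fps_nth_Abs_fps)
qed

lemma r_series_sums: "(\<lambda>n. fps_X ^ (2 ^ n - 1)) sums r_series"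
  unfolding r_series_def using r_series_sums_Abs sums_summable summable_sums by blast

lemma r_series_nth: "fps_nth r_series k = (if \<exists>n. k = 2 ^ n - 1 then 1 else 0)"
  unfolding r_series_def sums_unique[OF r_series_sums_Abs, symmetric] by simp

definition h_seq :: "nat \<Rightarrow> int" where
  "h_seq n = hankel_det (1 - fps_X * r_series) n"

text \<open>The operation \<open>y\<^sup>+\<close>: one step away from zero, with \<open>0\<close> counted among the
  negative numbers (so \<open>0\<^sup>+ = -1\<close>).\<close>

definition away :: "int \<Rightarrow> int" where
  "away y = (if y > 0 then y + 1 else y - 1)"

end

theory Submission
  imports Defs
begin

text \<open>
  The Hankel matrix of \<open>1 - x r(x)\<close> has the entry \<open>- 1\<close> where \<open>i + j\<close> is a power of 2, the entry
  \<open>1\<close> at the origin and \<open>0\<close> elsewhere. Give the corner entry an arbitrary value \<open>w\<close>, and let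
  \<open>K\<close> be the power of 2 with \<open>K / 2 \<le> m < K\<close>. In the matrix of size \<open>m + 1\<close>, row \<open>m\<close> has its only
  nonzero entry in column \<open>K - m\<close>, so the indices \<open>m\<close> and \<open>K - m\<close> can be removed together; then
  \<open>m - 1\<close> and \<open>K - m + 1\<close>, and so on. The remaining index \<open>K / 2\<close> is linked only to itself and to
  \<open>0\<close>, and removing it increases \<open>w\<close> by one. This leaves the matrix of size \<open>K - m\<close>, that is,
  \<open>m\<close> is replaced by the binary complement \<open>K - 1 - m\<close>. Hence the determinant is, up to sign,
  \<open>w\<close> plus the number of changes between adjacent binary digits of \<open>m\<close>, and the recurrences
  come from the effect of appending a digit to \<open>m\<close>.
\<close>

section \<open>Deleting rows and columns with a single nonzero entry\<close>

lemma det_single_entry_row: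
  fixes F :: "nat \<times> nat \<Rightarrow> 'a::comm_ring_1"
  assumes "p \<le> n" "a \<le> n" and z: "\<And>j. j \<le> n \<Longrightarrow> j \<noteq> a \<Longrightarrow> F (p, j) = 0"
  shows "det (mat (Suc n) (Suc n) F) = F (p, a) * (- 1) ^ (p + a) *
    det (mat n n (\<lambda>(i, j). F (if i < p then i else Suc i, if j < a then j else Suc j)))"
proof -
  let ?A = "mat (Suc n) (Suc n) F"
  have "det ?A = (\<Sum>j<Suc n. ?A $$ (p, j) * cofactor ?A p j)"
    by (rule laplace_expansion_row) (use assms in auto)
  also have "\<dots> = (\<Sum>j\<in>{a}. ?A $$ (p, j) * cofactor ?A p j)"
    by (rule sum.mono_neutral_right) (use assms in auto)
  also have "\<dots> = F (p, a) * (- 1) ^ (p + a) * det (mat_delete ?A p a)"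
    using assms by (simp add: cofactor_def mult.assoc)
  also have "mat_delete ?A p a =
      mat n n (\<lambda>(i, j). F (if i < p then i else Suc i, if j < a then j else Suc j))"
    using assms by (intro eq_matI) (auto simp: mat_delete_def)
  finally show ?thesis .
qed

lemma det_single_entry_col:
  fixes F :: "nat \<times> nat \<Rightarrow> 'a::comm_ring_1"
  assumes "p \<le> n" "a \<le> n" and z: "\<And>i. i \<le> n \<Longrightarrow> i \<noteq> a \<Longrightarrow> F (i, p) = 0"
  shows "det (mat (Suc n) (Suc n) F) = F (a, p) * (- 1) ^ (a + p) *
    det (mat n n (\<lambda>(i, j). F (if i < a then i else Suc i, if j < p then j else Suc j)))"
proof -
  let ?A = "mat (Suc n) (Suc n) F"
  have "det ?A = (\<Sum>i<Suc n. ?A $$ (i, p) * cofactor ?A i p)"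
    by (rule laplace_expansion_column) (use assms in auto)
  also have "\<dots> = (\<Sum>i\<in>{a}. ?A $$ (i, p) * cofactor ?A i p)"
    by (rule sum.mono_neutral_right) (use assms in auto)
  also have "\<dots> = F (a, p) * (- 1) ^ (a + p) * det (mat_delete ?A a p)"
    using assms by (simp add: cofactor_def mult.assoc)
  also have "mat_delete ?A a p =
      mat n n (\<lambda>(i, j). F (if i < a then i else Suc i, if j < p then j else Suc j))"
    using assms by (intro eq_matI) (auto simp: mat_delete_def)
  finally show ?thesis .
qed

text \<open>Expanding along the last row and then the last column removes the index
  \<open>Suc n\<close> and its only neighbour \<open>a\<close>. The two Laplace signs have exponents
  of opposite parity, whence the minus sign.\<close>

lemma det_leaf:
  fixes F :: "nat \<times> nat \<Rightarrow> 'a::comm_ring_1"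
  assumes "a \<le> n"
    and row: "\<And>j. j \<le> Suc n \<Longrightarrow> j \<noteq> a \<Longrightarrow> F (Suc n, j) = 0"
    and col: "\<And>i. i \<le> Suc n \<Longrightarrow> i \<noteq> a \<Longrightarrow> F (i, Suc n) = 0"
  shows "det (mat (Suc (Suc n)) (Suc (Suc n)) F) = - (F (Suc n, a) * F (a, Suc n) *
    det (mat n n (\<lambda>(i, j). F (if i < a then i else Suc i, if j < a then j else Suc j))))"
proof -
  let ?G = "\<lambda>(i, j). F (if i < Suc n then i else Suc i, if j < a then j else Suc j)"
  have 1: "det (mat (Suc (Suc n)) (Suc (Suc n)) F) = F (Suc n, a) * (- 1) ^ (Suc n + a) *
      det (mat (Suc n) (Suc n) ?G)"
    by (rule det_single_entry_row) (use assms in auto)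
  have 2: "det (mat (Suc n) (Suc n) ?G) = ?G (a, n) * (- 1) ^ (a + n) *
    det (mat n n (\<lambda>(i, j). ?G (if i < a then i else Suc i, if j < n then j else Suc j)))"
    by (rule det_single_entry_col) (use assms in auto)
  have 3: "mat n n (\<lambda>(i, j). ?G (if i < a then i else Suc i, if j < n then j else Suc j)) =
    mat n n (\<lambda>(i, j). F (if i < a then i else Suc i, if j < a then j else Suc j))"
    by (intro eq_matI) auto
  have 4: "(- 1 :: 'a) ^ (Suc n + a) * (- 1) ^ (a + n) = - 1"
    by (simp flip: power_add add: add.commute)
  have 5: "?G (a, n) = F (a, Suc n)" using assms by auto
  have "det (mat (Suc (Suc n)) (Suc (Suc n)) F) =
      ((- 1) ^ (Suc n + a) * (- 1) ^ (a + n)) * (F (Suc n, a) * F (a, Suc n) *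
    det (mat n n (\<lambda>(i, j). F (if i < a then i else Suc i, if j < a then j else Suc j))))"
    unfolding 1 2 3 5 by (simp only: ac_simps)
  then show ?thesis unfolding 4 by simp
qed

section \<open>The Hankel matrix and its nonzero entries\<close>

text \<open>With \<open>w\<close> in place of \<open>1\<close> in the corner, the reduction stays within one family.\<close>

definition entry :: "int \<Rightarrow> nat \<Rightarrow> nat \<Rightarrow> int" where
  "entry w i j = (if i = 0 \<and> j = 0 then w else if \<exists>k. i + j = 2 ^ k then - 1 else 0)"

definition h_weighted :: "nat \<Rightarrow> int \<Rightarrow> int" where
  "h_weighted n w = det (mat n n (\<lambda>(i, j). entry w i j))"

lemma entry_commute: "entry w i j = entry w j i"
  by (auto simp: entry_def add.commute)

lemma h_seq_eq_h_weighted: "h_seq n = h_weighted n 1"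
proof -
  have "fps_nth (1 - fps_X * r_series) (i + j) = entry 1 i j" for i j
  proof (cases "i + j")
    case 0
    then show ?thesis by (simp add: entry_def)
  next
    case (Suc m)
    have "(m = 2 ^ k - 1) = (Suc m = 2 ^ k)" for k :: nat
    proof -
      have "(0::nat) < 2 ^ k" by simp
      then show ?thesis by linarith
    qed
    then show ?thesis using Suc by (auto simp: entry_def r_series_nth)
  qed
  then show ?thesis
    unfolding h_seq_def hankel_det_def h_weighted_def by simp
qed

lemma power_of_2_between:
  fixes k l :: nat
  assumes "(2::nat) ^ k < 2 ^ l" "(2::nat) ^ l < 4 * 2 ^ k"
  shows "l = Suc k"
proof -
  have "k < l" using assms(1) by simp
  moreover have "(2::nat) ^ l < 2 ^ (k + 2)" using assms(2) by (simp add: power_add)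
  then have "l < k + 2" by (rule power_less_imp_less_exp[rotated]) simp
  ultimately show ?thesis by simp
qed

text \<open>The sum \<open>i + j\<close> lies strictly between \<open>2 ^ k\<close> and
  \<open>4 * 2 ^ k\<close>, where \<open>2 * 2 ^ k\<close> is the only power of 2.\<close>

lemma entry_upper:
  assumes "2 ^ k < i" "i < 2 * 2 ^ k" "j \<le> i"
  shows "entry w i j = (if i + j = 2 * 2 ^ k then - 1 else 0)"
proof -
  have "(\<exists>l. i + j = 2 ^ l) \<longleftrightarrow> i + j = 2 * 2 ^ k"
  proof
    assume "\<exists>l. i + j = 2 ^ l"
    then obtain l where l: "i + j = 2 ^ l" ..
    have "l = Suc k" by (rule power_of_2_between) (use l assms in linarith)+
    then show "i + j = 2 * 2 ^ k" using l by simp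
  next
    assume "i + j = 2 * 2 ^ k"
    then show "\<exists>l. i + j = 2 ^ l" by (intro exI[of _ "Suc k"]) simp
  qed
  then show ?thesis using assms by (auto simp: entry_def)
qed

lemma entry_power_of_2:
  assumes "j \<le> 2 ^ k"
  shows "entry w (2 ^ k) j = (if j = 0 \<or> j = 2 ^ k then - 1 else 0)"
proof -
  have "(\<exists>l. 2 ^ k + j = 2 ^ l) \<longleftrightarrow> j = 0 \<or> j = 2 ^ k"
  proof
    assume "\<exists>l. 2 ^ k + j = 2 ^ l"
    then obtain l where l: "2 ^ k + j = 2 ^ l" ..
    have "l = Suc k" if "j \<noteq> 0"
    proof (rule power_of_2_between)
      show "(2::nat) ^ k < 2 ^ l" using l that by linarith
      have "(0::nat) < 2 ^ k" by simp
      then show "(2::nat) ^ l < 4 * 2 ^ k" using l assms by linarith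
    qed
    then show "j = 0 \<or> j = 2 ^ k" using l by (cases "j = 0") auto
  next
    assume "j = 0 \<or> j = 2 ^ k"
    moreover have "(2::nat) ^ k + 2 ^ k = 2 ^ Suc k" by simp
    ultimately show "\<exists>l. 2 ^ k + j = 2 ^ l" by (metis add_0_right)
  qed
  then show ?thesis by (auto simp: entry_def)
qed

section \<open>Reduction of the determinant\<close>

text \<open>Subtracting the column of the index \<open>2 ^ k\<close> from column \<open>0\<close>
  clears the entry at \<open>(a, 0)\<close> and turns the corner into \<open>w - (- 1)\<close>. Row
  \<open>a\<close> is then left with its diagonal entry \<open>- 1\<close> alone.\<close>

lemma det_remove_root:
  assumes a: "0 < a" "a \<le> 2 ^ k"
  shows "det (mat (Suc a) (Suc a) (\<lambda>(i, j).
      entry w (if i < a then i else 2 ^ k) (if j < a then j else 2 ^ k))) = - h_weighted a (w + 1)"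
proof -
  let ?A = "mat (Suc a) (Suc a) (\<lambda>(i, j).
      entry w (if i < a then i else 2 ^ k) (if j < a then j else 2 ^ k))"
  let ?F = "\<lambda>(i, j). if i = a then (if j = a then - 1 else 0)
      else if j = a then entry w i (2 ^ k) else entry (w + 1) i j"
  have root: "entry w (2 ^ k) (2 ^ k) = - 1" "entry w (2 ^ k) 0 = - 1" "entry w 0 (2 ^ k) = - 1"
    by (simp_all add: entry_power_of_2 entry_commute[of w 0])
  have nonroot: "entry w i (2 ^ k) = 0" if "0 < i" "i < a" for i
    using that a by (simp add: entry_power_of_2 entry_commute[of w i])
  have "det ?A = det (addcol (- 1) 0 a ?A)"
    by (rule det_addcol[symmetric]) (use a in auto)
  also have "addcol (- 1) 0 a ?A = mat (Suc a) (Suc a) ?F"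
  proof (rule eq_matI, goal_cases)
    case (1 i j)
    then have ij: "i \<le> a" "j \<le> a" by auto
    have shift: "entry (w + 1) i j = entry w i j + (if i = 0 \<and> j = 0 then 1 else 0)" for i j
      by (simp add: entry_def)
    consider "j = 0" "i = 0" | "j = 0" "0 < i" "i < a" | "j = 0" "i = a" | "0 < j" using ij by linarith
    then show ?case
      by cases (use ij a root nonroot[of i] nonroot[of j] in
        \<open>auto simp: shift entry_commute[of w "2 ^ k" j]\<close>)
  qed auto
  also have "det (mat (Suc a) (Suc a) ?F) = ?F (a, a) * (- 1) ^ (a + a) *
    det (mat a a (\<lambda>(i, j). ?F (if i < a then i else Suc i, if j < a then j else Suc j)))"
    by (rule det_single_entry_row) auto
  also have "mat a a (\<lambda>(i, j). ?F (if i < a then i else Suc i, if j < a then j else Suc j)) =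
      mat a a (\<lambda>(i, j). entry (w + 1) i j)"
    by (intro eq_matI) auto
  finally show ?thesis by (simp add: h_weighted_def)
qed

text \<open>The indices that are left are \<open>0, \<dots>, a - 1\<close> and \<open>2 ^ k - t, \<dots>, 2 ^ k + t\<close>.\<close>

lemma det_remove_pairs:
  assumes "0 < a" "a + t \<le> 2 ^ k"
  shows "det (mat (a + 2 * t + 1) (a + 2 * t + 1) (\<lambda>(i, j).
      entry w (if i < a then i else i - a + (2 ^ k - t)) (if j < a then j else j - a + (2 ^ k - t))))
    = - ((- 1) ^ t * h_weighted a (w + 1))"
  using assms
proof (induction t)
  case 0
  have "mat (Suc a) (Suc a) (\<lambda>(i, j).
      entry w (if i < a then i else i - a + 2 ^ k) (if j < a then j else j - a + 2 ^ k)) =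
    mat (Suc a) (Suc a) (\<lambda>(i, j).
      entry w (if i < a then i else 2 ^ k) (if j < a then j else 2 ^ k))"
    by (intro eq_matI) (auto simp: less_Suc_eq)
  then show ?case using det_remove_root[of a k w] 0 by (simp cong: if_cong)
next
  case (Suc t)
  \<comment> \<open>\<open>f\<close> sends a position to the index that it stands for. Position
    \<open>a\<close> holds \<open>2 ^ k - Suc t\<close> and the last one holds
    \<open>2 ^ k + Suc t\<close>. Their sum is \<open>2 * 2 ^ k\<close>, so this is the pair to
    remove.\<close>
  define f where "f i = (if i < a then i else i - a + (2 ^ k - Suc t))" for i
  let ?n = "a + 2 * t + 1"
  let ?F = "\<lambda>(i, j). entry w (f i) (f j)"
  have last: "f (Suc ?n) = 2 ^ k + Suc t" using Suc.prems by (simp add: f_def)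
  have row: "entry w (f (Suc ?n)) (f j) = (if j = a then - 1 else 0)" if "j \<le> Suc ?n" for j
  proof -
    have "entry w (f (Suc ?n)) (f j) = (if f (Suc ?n) + f j = 2 * 2 ^ k then - 1 else 0)"
    proof (rule entry_upper)
      show "f j \<le> f (Suc ?n)" unfolding last using that Suc.prems by (auto simp: f_def)
    qed (use last Suc.prems in simp_all)
    moreover have "f (Suc ?n) + f j = 2 * 2 ^ k \<longleftrightarrow> j = a"
      unfolding last using that Suc.prems by (auto simp: f_def)
    ultimately show ?thesis by simp
  qed
  then have col: "entry w (f i) (f (Suc ?n)) = (if i = a then - 1 else 0)" if "i \<le> Suc ?n" for i
    using that by (simp add: entry_commute[of w "f i"])
  have "det (mat (Suc (Suc ?n)) (Suc (Suc ?n)) ?F) = - (?F (Suc ?n, a) * ?F (a, Suc ?n) *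
    det (mat ?n ?n (\<lambda>(i, j). ?F (if i < a then i else Suc i, if j < a then j else Suc j))))"
    by (rule det_leaf) (use row col in auto)
  also have "?F (Suc ?n, a) = - 1" using row[of a] by simp
  also have "?F (a, Suc ?n) = - 1" using col[of a] by simp
  also have "mat ?n ?n (\<lambda>(i, j). ?F (if i < a then i else Suc i, if j < a then j else Suc j)) =
    mat ?n ?n (\<lambda>(i, j). entry w (if i < a then i else i - a + (2 ^ k - t))
      (if j < a then j else j - a + (2 ^ k - t)))"
  proof -
    \<comment> \<open>Without position \<open>a\<close> the second block starts one index later, at
      \<open>2 ^ k - t\<close>.\<close>
    have "f (if i < a then i else Suc i) = (if i < a then i else i - a + (2 ^ k - t))" for i
      using Suc.prems by (auto simp: f_def)
    then show ?thesis by simp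
  qed
  also have "det \<dots> = - ((- 1) ^ t * h_weighted a (w + 1))"
    by (rule Suc.IH) (use Suc.prems in auto)
  finally show ?case by (simp add: f_def)
qed

text \<open>For \<open>t = m - 2 ^ k\<close> and \<open>a = 2 ^ Suc k - m\<close> one has
  \<open>2 ^ k - t = a\<close>: the two blocks of indices are adjacent, and positions coincide with
  indices.\<close>

lemma h_weighted_reflect:
  assumes "2 ^ k \<le> m" "m < 2 ^ Suc k"
  shows "h_weighted (Suc m) w = - ((- 1) ^ (m - 2 ^ k) * h_weighted (2 ^ Suc k - m) (w + 1))"
proof -
  let ?a = "2 ^ Suc k - m" and ?t = "m - 2 ^ k"
  have "?a + 2 * ?t + 1 = Suc m" using assms by auto
  moreover have "(if i < ?a then i else i - ?a + (2 ^ k - ?t)) = i" for i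
    using assms by auto
  ultimately show ?thesis
    using det_remove_pairs[of ?a ?t k w] assms by (simp add: h_weighted_def)
qed

section \<open>Changes between binary digits\<close>

text \<open>The leading digit counts as a change from the implicit \<open>0\<close> before it.\<close>

fun bit_changes :: "nat \<Rightarrow> nat" where
  "bit_changes m = (if m = 0 then 0
     else bit_changes (m div 2) + (if m mod 4 \<in> {1, 2} then 1 else 0))"

declare bit_changes.simps [simp del]

lemma bit_changes_0 [simp]: "bit_changes 0 = 0"
  by (simp add: bit_changes.simps)

text \<open>The residues 1 and 2 modulo 4 are those whose two binary digits differ.\<close>

lemma bit_changes_rec:
  "bit_changes m = bit_changes (m div 2) + (if m mod 4 \<in> {1, 2} then 1 else 0)"
  by (cases "m = 0") (simp_all add: bit_changes.simps[of m])

lemma bit_changes_1: "bit_changes (Suc 0) = 1"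
  by (simp add: bit_changes.simps[of "Suc 0"])

text \<open>Complementing all \<open>k + 1\<close> digits keeps every change among them. The leading
  digit becomes 0, so only the change in front of it is lost.\<close>

lemma bit_changes_complement:
  assumes "2 ^ k \<le> m" "m < 2 ^ Suc k"
  shows "bit_changes m = Suc (bit_changes (2 ^ Suc k - 1 - m))"
  using assms
proof (induction k arbitrary: m)
  case 0
  then have "m = 1" by simp
  then show ?case by (simp add: bit_changes_1)
next
  case (Suc k)
  let ?m = "2 ^ Suc (Suc k) - 1 - m"
  have IH: "bit_changes (m div 2) = Suc (bit_changes (2 ^ Suc k - 1 - m div 2))"
    by (rule Suc.IH) (use Suc.prems in auto)
  have half: "?m div 2 = 2 ^ Suc k - 1 - m div 2" using Suc.prems by auto
  have "?m mod 4 = 3 - m mod 4"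
  proof -
    have "m div 4 < 2 ^ k" using Suc.prems by (simp add: div_less_iff_less_mult)
    moreover have "(2::nat) ^ Suc (Suc k) = 4 * 2 ^ k" by simp
    ultimately have "?m = 3 - m mod 4 + 4 * (2 ^ k - 1 - m div 4)"
      using div_mult_mod_eq[of m 4] mod_less_divisor[of 4 m] by linarith
    then have "?m mod 4 = (3 - m mod 4) mod 4" by (simp only: mod_mult_self2)
    then show ?thesis by simp
  qed
  then have "?m mod 4 \<in> {1, 2} \<longleftrightarrow> m mod 4 \<in> {1, 2}" by auto
  then show ?case
    using IH half bit_changes_rec[of m] bit_changes_rec[of ?m] by simp
qed

text \<open>Induction passes from \<open>m\<close> to its smaller complement: one change is lost,
  and \<open>w\<close> grows by one to make up for it. The halving is exact, as the number of
  changes, counted from a leading 0, has the parity of the last digit.\<close>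

lemma h_weighted_Suc:
  "h_weighted (Suc m) w = (- 1) ^ ((m + bit_changes m) div 2) * (w + int (bit_changes m))"
proof (induction m arbitrary: w rule: less_induct)
  case (less m)
  show ?case
  proof (cases "m = 0")
    case True
    then show ?thesis by (simp add: h_weighted_def det_def entry_def)
  next
    case False
    then obtain k where k: "2 ^ k \<le> m" "m < 2 ^ Suc k"
      using ex_power_ivl1[of 2 m] by auto
    let ?m = "2 ^ Suc k - 1 - m"
    have Suc_m: "2 ^ Suc k - m = Suc ?m" using k by simp
    have lt: "?m < m" using k by simp
    have c: "bit_changes m = Suc (bit_changes ?m)" by (rule bit_changes_complement[OF k])
    \<comment> \<open>One sign comes from each of the \<open>m - 2 ^ k\<close> pairs and one from
      the index \<open>2 ^ k\<close>.\<close>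
    have exponent: "(m + bit_changes m) div 2 = Suc (m - 2 ^ k) + (?m + bit_changes ?m) div 2"
      using k unfolding c by simp
    show ?thesis
      unfolding h_weighted_reflect[OF k] Suc_m less[OF lt] exponent power_add by (simp add: c algebra_simps)
  qed
qed

section \<open>Comparison of determinants of two sizes\<close>

lemma h_seq_Suc:
  "h_seq (Suc m) = (- 1) ^ ((m + bit_changes m) div 2) * (1 + int (bit_changes m))"
  by (simp add: h_seq_eq_h_weighted h_weighted_Suc)

lemma h_seq_transfer:
  assumes "bit_changes m = bit_changes n" "m = n + 2 * d" "M = Suc m" "N = Suc n"
  shows "h_seq M = (- 1) ^ d * h_seq N"
proof -
  have "(m + bit_changes m) div 2 = d + (n + bit_changes n) div 2"
    using assms by simp
  then show ?thesis by (simp add: assms(3,4) h_seq_Suc assms(1) power_add)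
qed

text \<open>One more change raises the absolute value by one and adds 1 to the sum that is halved,
  hence \<open>Suc m\<close>. Since \<open>h_seq N\<close> is nonzero, \<open>away\<close> commutes
  with the sign.\<close>

lemma h_seq_transfer_away:
  assumes "bit_changes m = Suc (bit_changes n)" "Suc m = n + 2 * d" "M = Suc m" "N = Suc n"
  shows "h_seq M = (- 1) ^ d * away (h_seq N)"
proof -
  have "(m + bit_changes m) div 2 = d + (n + bit_changes n) div 2"
    using assms by simp
  then show ?thesis
    by (cases "even ((n + bit_changes n) div 2)")
      (simp_all add: assms(3,4) h_seq_Suc assms(1) power_add away_def algebra_simps)
qed

lemma bit_changes_four:
  "bit_changes (4 * n) = bit_changes (2 * n)"
  "bit_changes (4 * n + 1) = Suc (bit_changes (2 * n))"
  "bit_changes (4 * n + 2) = Suc (bit_changes (2 * n + 1))"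
  "bit_changes (4 * n + 3) = bit_changes (2 * n + 1)"
proof -
  have "(4 * n) div 2 = 2 * n" "(4 * n + 1) div 2 = 2 * n"
    "(4 * n + 2) div 2 = 2 * n + 1" "(4 * n + 3) div 2 = 2 * n + 1"
    "(4 * n) mod 4 = 0" "(4 * n + 1) mod 4 = 1"
    "(4 * n + 2) mod 4 = 2" "(4 * n + 3) mod 4 = 3"
    by presburger+
  note arith = this
  show "bit_changes (4 * n) = bit_changes (2 * n)"
    by (subst bit_changes_rec) (simp only: arith, simp)
  show "bit_changes (4 * n + 1) = Suc (bit_changes (2 * n))"
    by (subst bit_changes_rec) (simp only: arith, simp)
  show "bit_changes (4 * n + 2) = Suc (bit_changes (2 * n + 1))"
    by (subst bit_changes_rec) (simp only: arith, simp)
  show "bit_changes (4 * n + 3) = bit_changes (2 * n + 1)"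
    by (subst bit_changes_rec) (simp only: arith, simp)
qed

text \<open>Deleting one of two equal adjacent digits keeps the number of changes. The alternating
  endings 010 and 101 lose one change with their last digit.\<close>

lemma bit_changes_eight:
  "bit_changes (8 * n) = bit_changes (4 * n)"
  "bit_changes (8 * n + 1) = bit_changes (4 * n + 1)"
  "bit_changes (8 * n + 2) = Suc (bit_changes (4 * n + 1))"
  "bit_changes (8 * n + 3) = bit_changes (4 * n + 1)"
  "bit_changes (8 * n + 4) = bit_changes (4 * n + 2)"
  "bit_changes (8 * n + 5) = Suc (bit_changes (4 * n + 2))"
  "bit_changes (8 * n + 6) = bit_changes (4 * n + 2)"
  "bit_changes (8 * n + 7) = bit_changes (4 * n + 3)"
proof -
  have eqs: "8 * n = 4 * (2 * n)" "2 * (2 * n) = 4 * n" by simp_all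
  show "bit_changes (8 * n) = bit_changes (4 * n)"
    "bit_changes (8 * n + 1) = bit_changes (4 * n + 1)"
    "bit_changes (8 * n + 2) = Suc (bit_changes (4 * n + 1))"
    "bit_changes (8 * n + 3) = bit_changes (4 * n + 1)"
    by (simp_all only: eqs bit_changes_four)
  have eqs: "8 * n + 4 = 4 * (2 * n + 1)" "8 * n + 5 = 4 * (2 * n + 1) + 1"
    "8 * n + 6 = 4 * (2 * n + 1) + 2" "8 * n + 7 = 4 * (2 * n + 1) + 3"
    "2 * (2 * n + 1) = 4 * n + 2" "4 * n + 2 + 1 = 4 * n + 3" by simp_all
  show "bit_changes (8 * n + 4) = bit_changes (4 * n + 2)"
    "bit_changes (8 * n + 5) = Suc (bit_changes (4 * n + 2))"
    "bit_changes (8 * n + 6) = bit_changes (4 * n + 2)"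
    "bit_changes (8 * n + 7) = bit_changes (4 * n + 3)"
    by (simp_all only: eqs bit_changes_four)
qed

theorem theorem24:
  shows "h_seq 0 = 1 \<and> h_seq 1 = 1 \<and> h_seq 2 = -2 \<and>
    (\<forall>n.
      h_seq (8 * n) = h_seq (4 * n) \<and>
      h_seq (8 * n + 1) = h_seq (4 * n + 1) \<and>
      h_seq (8 * n + 2) = h_seq (4 * n + 2) \<and>
      h_seq (8 * n + 3) = - away (h_seq (4 * n + 2)) \<and>
      h_seq (8 * n + 4) = - h_seq (4 * n + 2) \<and>
      h_seq (8 * n + 5) = - h_seq (4 * n + 3) \<and>
      h_seq (8 * n + 6) = away (h_seq (4 * n + 3)) \<and>
      h_seq (8 * n + 7) = h_seq (4 * n + 3))"
proof (intro conjI allI)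
  show "h_seq 0 = 1" by (simp add: h_seq_def)
  show "h_seq 1 = 1" using h_seq_Suc[of 0] by simp
  show "h_seq 2 = -2" using h_seq_Suc[of 1] by (simp add: bit_changes_1 eval_nat_numeral)
  fix n
  show "h_seq (8 * n) = h_seq (4 * n)"
  \<comment> \<open>The relevant digits are those of \<open>8 * n - 1\<close>, which is
    \<open>8 * k + 7\<close> for \<open>n = Suc k\<close>. At \<open>n = 0\<close> both sizes are
    0.\<close>
  proof (cases n)
    case (Suc k)
    then have "h_seq (8 * n) = (- 1) ^ (2 * k + 2) * h_seq (4 * n)"
      by (intro h_seq_transfer[OF bit_changes_eight(8)[of k]]) simp_all
    then show ?thesis by simp
  qed simp
  \<comment> \<open>Here and below, each exponent is half the difference of the two sizes, after
    adding 1 to it in the \<open>away\<close> cases.\<close>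
  have "h_seq (8 * n + 1) = (- 1) ^ (2 * n) * h_seq (4 * n + 1)"
    by (rule h_seq_transfer[OF bit_changes_eight(1)]) simp_all
  then show "h_seq (8 * n + 1) = h_seq (4 * n + 1)" by simp
  have "h_seq (8 * n + 2) = (- 1) ^ (2 * n) * h_seq (4 * n + 2)"
    by (rule h_seq_transfer[OF bit_changes_eight(2)]) simp_all
  then show "h_seq (8 * n + 2) = h_seq (4 * n + 2)" by simp
  have "h_seq (8 * n + 3) = (- 1) ^ (2 * n + 1) * away (h_seq (4 * n + 2))"
    by (rule h_seq_transfer_away[OF bit_changes_eight(3)]) simp_all
  then show "h_seq (8 * n + 3) = - away (h_seq (4 * n + 2))" by simp
  have "h_seq (8 * n + 4) = (- 1) ^ (2 * n + 1) * h_seq (4 * n + 2)"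
    by (rule h_seq_transfer[OF bit_changes_eight(4)]) simp_all
  then show "h_seq (8 * n + 4) = - h_seq (4 * n + 2)" by simp
  have "h_seq (8 * n + 5) = (- 1) ^ (2 * n + 1) * h_seq (4 * n + 3)"
    by (rule h_seq_transfer[OF bit_changes_eight(5)]) simp_all
  then show "h_seq (8 * n + 5) = - h_seq (4 * n + 3)" by simp
  have "h_seq (8 * n + 6) = (- 1) ^ (2 * n + 2) * away (h_seq (4 * n + 3))"
    by (rule h_seq_transfer_away[OF bit_changes_eight(6)]) simp_all
  then show "h_seq (8 * n + 6) = away (h_seq (4 * n + 3))" by simp
  have "h_seq (8 * n + 7) = (- 1) ^ (2 * n + 2) * h_seq (4 * n + 3)"
    by (rule h_seq_transfer[OF bit_changes_eight(7)]) simp_all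
  then show "h_seq (8 * n + 7) = h_seq (4 * n + 3)" by simp
qed

end
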